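(* Let $f,g\in\Sigma$ be locally univalent functions in $\mathbb{U}^{*}$ and let $\alpha\in\mathbb{C}$ be arbitrary. If there exists an analytic function $h$ such that $\operatorname{Re}h(\zeta)\ge \frac12$ and $h(\zeta)=1+\frac{h_{2}}{\zeta^{2}}+\cdots$ for $\zeta\in\mathbb{U}^{*}$, and such that $$\left|\frac{1-h(\zeta)}{h(\zeta)}|\zeta|^{2}-(|\zeta|^{2}-1)\left[\frac{\zeta h'(\zeta)}{h(\zeta)}+(1-2\alpha)\frac{\zeta f''(\zeta)}{f'(\zeta)}+2\alpha\frac{\zeta g''(\zeta)}{g'(\zeta)}\right]+\alpha(|\zeta|^{2}-1)^{2}\,\frac{\zeta}{\overline{\zeta}}\,h(\zeta)\left[\left(\alpha-\frac12\right)\left(\frac{f''(\zeta)}{f'(\zeta)}-\frac{g''(\zeta)}{g'(\zeta)}\right)^{2}+S_{f}(\zeta)-S_{g}(\zeta)\right]\right|\le 1$$ for all $\zeta\in\mathbb{U}^{*}$, then $f$ is univalent in $\mathbb{U}^{*}$.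
   Context: $\mathbb{U}=\{z\in\mathbb{C}:|z|<1\}$ is the open unit disk, $\overline{\mathbb{U}}$ is its closure, and $\mathbb{U}^{*}=\mathbb{C}\setminus\overline{\mathbb{U}}$. $\Sigma$ denotes the class of all meromorphic functions $f$ in $\mathbb{U}^{*}$ of the form $f(\zeta)=b\zeta+b_{0}+\frac{b_{1}}{\zeta}+\cdots$ $(\zeta\in\mathbb{U}^{*})$. Univalent means injective, and locally univalent means injective in a neighbourhood of each point. The Schwarzian derivative of $f$ is $$S_{f}(z)=\left(\frac{f''(z)}{f'(z)}\right)'-\frac12\left(\frac{f''(z)}{f'(z)}\right)^{2},$$ and $S_g$ is defined likewise.
   Formalization: The leading coefficient b in the class Σ is required to be nonzero; if b = 0 is allowed the claim fails, e.g. f(ζ)=1/ζ², g(ζ)=ζ, h=1, α=1/3. *)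

theory Defs
  imports "HOL-Complex_Analysis.Complex_Analysis"
begin

definition ext_disk :: "complex set" where
  "ext_disk = - cball 0 1"

text \<open>
  The Laurent expansion is required on all of \<open>ext_disk\<close>, so the only pole of a member of this
  class is the one at infinity. The condition \<open>b \<noteq> 0\<close> makes infinity a genuine simple pole.
\<close>

definition class_Sigma :: "(complex \<Rightarrow> complex) set" where
  "class_Sigma = {f. f meromorphic_on ext_disk \<and>
     (\<exists>b c. b \<noteq> 0 \<and> (\<forall>\<zeta>\<in>ext_disk. (\<lambda>n. c n / \<zeta> ^ n) sums (f \<zeta> - b * \<zeta>)))}"

definition univalent_on :: "(complex \<Rightarrow> complex) \<Rightarrow> complex set \<Rightarrow> bool" where
  "univalent_on f S \<longleftrightarrow> inj_on f S"

definition locally_univalent_on :: "(complex \<Rightarrow> complex) \<Rightarrow> complex set \<Rightarrow> bool" where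
  "locally_univalent_on f S \<longleftrightarrow>
     (\<forall>z\<in>S. \<exists>V. open V \<and> z \<in> V \<and> V \<subseteq> S \<and> univalent_on f V)"

definition pre_schwarzian :: "(complex \<Rightarrow> complex) \<Rightarrow> complex \<Rightarrow> complex" where
  "pre_schwarzian f z = deriv (deriv f) z / deriv f z"

definition schwarzian :: "(complex \<Rightarrow> complex) \<Rightarrow> complex \<Rightarrow> complex" where
  "schwarzian f z = deriv (pre_schwarzian f) z - 1/2 * (pre_schwarzian f z)\<^sup>2"

end

theory Submission imports Defs begin

text \<open>
  The criterion comes from the Loewner chain
  \<open>F(\<zeta>, s) = f(\<zeta>) - (1 - s) \<zeta> h f' / (1 + \<alpha> (1 - s) \<zeta> h (f''/f' - g''/g'))\<close>,
  where \<open>s = e\<^bsup>-2t\<^esup>\<close> runs from \<open>1\<close> down to \<open>0\<close>, the functions on the right are taken at \<open>\<zeta>\<close>, and the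
  chain at time \<open>t\<close> is the map \<open>z \<mapsto> F(e\<^bsup>t\<^esup> z, s)\<close>. It starts at \<open>f\<close>, and far out it looks like
  \<open>b s \<zeta> + b\<^sub>0\<close>, which is injective. If \<open>L\<close> is the factor in its Loewner equation \<open>\<partial>\<^sub>t F = - L z \<partial>\<^sub>z F\<close>, then on the
  circle \<open>|\<zeta>|\<^sup>2 s = 1\<close> the expression in the hypothesis is exactly \<open>- (L - 1) / (L + 1)\<close>, so the hypothesis
  says \<open>Re L \<ge> 0\<close> there, and the maximum principle carries this outwards.

  The flow need not be constructed, because \<open>F\<close> is a Moebius function of \<open>s\<close>: for a fixed value \<open>w\<close>,
  the equation \<open>F(\<zeta>, s) = w\<close> can be solved explicitly as \<open>s = H(1 / \<zeta>)\<close> with \<open>H\<close> meromorphic in the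
  unit disk and \<open>H(0) = 0\<close>. The preimages of \<open>w\<close> under \<open>f\<close> are points where \<open>H = 1\<close>, and the characteristics
  of the Loewner equation through them are the curves along which \<open>H\<close> is real and runs from \<open>1\<close> to \<open>0\<close>.
  The identity \<open>log_derivative_identity\<close> turns the hypothesis, sharpened by the Schwarz lemma, into
  \<open>|1 - x H'(x) / H(x)| \<le> |x| / \<surd>H(x)\<close> wherever \<open>|x|\<^sup>2 < H(x) \<le> 1\<close>.

  This bound has three consequences, which together give \<open>at_most_one_zero\<close>. It forces \<open>H' \<noteq> 0\<close>, so a point
  on a level can be continued to a nearby level; it makes \<open>|x|\<^sup>2 / H(x)\<close> decrease as the level decreases, so
  the continued point stays where the bound applies (\<open>level_curve_descends\<close>); and it makes the zero
  of \<open>H\<close> at the origin simple (\<open>simple_zero_if_log_derivative_near_1\<close>). Two distinct points on the level \<open>1\<close>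
  would therefore persist as two distinct points on every positive level. They would both tend to the origin
  as the level tends to \<open>0\<close>, but \<open>H\<close> is injective there.
\<close>

section \<open>Continuation along real levels of a holomorphic function\<close>

text \<open>
  Let \<open>\<psi>\<close> be the local inverse of \<open>H\<close> at \<open>y\<close> and put \<open>a = y H'(y) / s\<close>. The logarithmic derivative
  of \<open>|\<psi>(\<tau>)|\<^sup>2 / \<tau>\<close> at \<open>\<tau> = s\<close> is \<open>(2 Re (1 / a) - 1) / s\<close>, and it is positive because \<open>|1 - a| < 1\<close> says
  \<open>|a|\<^sup>2 < 2 Re a\<close>. The parameter \<open>e\<close> keeps continuations of different points apart.
\<close>

lemma level_curve_descends:
  fixes H :: "complex \<Rightarrow> complex" and s e :: real
  assumes holH: "H holomorphic_on K" and K: "open K" "y \<in> K"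
    and Hy: "H y = of_real s" and s: "0 < s" and e: "0 < e"
    and bd: "cmod (1 - y * deriv H y / of_real s) < 1"
  obtains \<delta> where "\<delta> > 0"
    "\<And>\<tau>. s - \<delta> < \<tau> \<Longrightarrow> \<tau> < s \<Longrightarrow>
       \<exists>y'\<in>K \<inter> ball y e. H y' = of_real \<tau> \<and> (cmod y')\<^sup>2 / \<tau> < (cmod y)\<^sup>2 / s"
proof -
  define d where "d = deriv H y"
  have dnz: "d \<noteq> 0"
    using bd by (auto simp: d_def)
  have "H holomorphic_on K \<inter> ball y e"
    using holH holomorphic_on_subset by blast
  then obtain r where r: "r > 0" "ball y r \<subseteq> K \<inter> ball y e" "open (H ` ball y r)" "inj_on H (ball y r)"
    using has_complex_derivative_locally_invertible[of H "K \<inter> ball y e" y] K e dnz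
    by (auto simp: d_def)
  have holHr: "H holomorphic_on ball y r"
    using holH r(2) holomorphic_on_subset by blast
  obtain \<psi> where \<psi>: "\<psi> holomorphic_on H ` ball y r"
    "\<And>z. z \<in> ball y r \<Longrightarrow> deriv H z * deriv \<psi> (H z) = 1"
    "\<And>z. z \<in> ball y r \<Longrightarrow> \<psi> (H z) = z"
    using holomorphic_has_inverse[OF holHr _ r(4)] by auto
  have yr: "y \<in> ball y r" using r by simp
  have \<psi>s: "\<psi> (of_real s) = y"
    using \<psi>(3)[OF yr] Hy by simp
  have sin: "of_real s \<in> H ` ball y r"
    using yr Hy by (metis image_eqI)
  have d\<psi>: "(\<psi> has_field_derivative 1 / d) (at (of_real s))"
  proof -
    have "(\<psi> has_field_derivative deriv \<psi> (of_real s)) (at (of_real s))"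
      using \<psi>(1) r(3) sin by (meson holomorphic_derivI)
    moreover have "deriv \<psi> (of_real s) = 1 / d"
      using \<psi>(2)[OF yr] Hy dnz by (simp add: d_def field_simps)
    ultimately show ?thesis by simp
  qed
  have vd: "((\<lambda>\<tau>. \<psi> (of_real \<tau>)) has_vector_derivative 1 / d) (at s)"
    using has_vector_derivative_real_field[OF d\<psi>] by simp
  define G where "G \<tau> = ((Re (\<psi> (of_real \<tau>)))\<^sup>2 + (Im (\<psi> (of_real \<tau>)))\<^sup>2) / \<tau>" for \<tau> :: real
  define L where "L = (2 * (Re y * Re (1 / d) + Im y * Im (1 / d)) * s - (cmod y)\<^sup>2) / s\<^sup>2"
  have dG: "(G has_real_derivative L) (at s)"
    unfolding G_def L_def cmod_power2
    using s by (auto intro!: derivative_eq_intros vd simp: \<psi>s power2_eq_square field_simps)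
  have Lpos: "L > 0"
  proof -
    define a where "a = y * d / of_real s"
    have y: "y = of_real s * a / d"
      using dnz s by (simp add: a_def)
    have "(cmod (1 - a))\<^sup>2 < 1"
      using bd by (simp add: a_def d_def power_less_one_iff)
    then have a: "2 * Re a > (cmod a)\<^sup>2"
      unfolding cmod_power2 by (simp add: power2_eq_square algebra_simps)
    have "Re y * Re v + Im y * Im v = Re (y * cnj v)" for v
      by simp
    then have "Re y * Re (1 / d) + Im y * Im (1 / d) = Re (y * cnj (1 / d))" .
    also have "y * cnj (1 / d) = of_real (s / (cmod d)\<^sup>2) * a"
      using dnz by (simp add: y complex_norm_square del: of_real_power)
    finally have 1: "Re y * Re (1 / d) + Im y * Im (1 / d) = s / (cmod d)\<^sup>2 * Re a"
      by simp
    have 2: "(cmod y)\<^sup>2 = s / (cmod d)\<^sup>2 * s * (cmod a)\<^sup>2"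
      using s by (simp add: y norm_mult norm_divide power_mult_distrib power_divide power2_eq_square)
    have "2 * (Re y * Re (1 / d) + Im y * Im (1 / d)) * s - (cmod y)\<^sup>2
        = s / (cmod d)\<^sup>2 * s * (2 * Re a - (cmod a)\<^sup>2)"
      unfolding 1 2 by (simp add: algebra_simps)
    also have "\<dots> > 0"
      using a s dnz by simp
    finally show ?thesis
      using s by (simp add: L_def)
  qed
  obtain \<delta>1 where \<delta>1: "\<delta>1 > 0" "\<And>t. 0 < t \<Longrightarrow> t < \<delta>1 \<Longrightarrow> G (s - t) < G s"
    using DERIV_pos_inc_left[OF dG Lpos] by blast
  obtain \<delta>2 where \<delta>2: "\<delta>2 > 0" "ball (of_real s) \<delta>2 \<subseteq> H ` ball y r"
    using r(3) sin openE by metis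
  show ?thesis
  proof (rule that[of "min \<delta>1 \<delta>2"])
    fix \<tau> assume \<tau>: "s - min \<delta>1 \<delta>2 < \<tau>" "\<tau> < s"
    have "complex_of_real \<tau> \<in> ball (of_real s) \<delta>2"
      using \<tau> by (simp add: dist_norm flip: of_real_diff)
    then obtain y' where y': "y' \<in> ball y r" "H y' = of_real \<tau>"
      using \<delta>2(2) by (metis imageE subsetD)
    have "G \<tau> < G s"
      using \<delta>1(2)[of "s - \<tau>"] \<tau> by simp
    moreover have "\<psi> (of_real \<tau>) = y'"
      using \<psi>(3)[OF y'(1)] y'(2) by simp
    ultimately have "(cmod y')\<^sup>2 / \<tau> < (cmod y)\<^sup>2 / s"
      by (simp add: G_def \<psi>s cmod_power2)
    then show "\<exists>y'\<in>K \<inter> ball y e. H y' = of_real \<tau> \<and> (cmod y')\<^sup>2 / \<tau> < (cmod y)\<^sup>2 / s"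
      using y' r(2) by blast
  qed (use \<delta>1 \<delta>2 in auto)
qed

text \<open>
  At a zero of order \<open>m\<close> the quotient \<open>w H'(w) / H(w)\<close> tends to \<open>m\<close>, and \<open>|1 - m| < 1\<close> leaves only \<open>m = 1\<close>.
\<close>

lemma simple_zero_if_log_derivative_near_1:
  fixes H :: "complex \<Rightarrow> complex"
  assumes holH: "H holomorphic_on S" and S: "open S" "connected S" "0 \<in> S"
    and H0: "H 0 = 0" and nc: "\<not> H constant_on S"
    and y: "y \<longlonglongrightarrow> 0" and ynz: "\<And>n::nat. y n \<noteq> 0" and "\<rho> < 1"
    and bd: "\<And>n. cmod (1 - y n * deriv H (y n) / H (y n)) \<le> \<rho>"
  shows "deriv H 0 \<noteq> 0"
proof -
  obtain g r m where f: "0 < m" "0 < r" "ball 0 r \<subseteq> S" "g holomorphic_on ball 0 r"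
     "\<And>w. w \<in> ball 0 r \<Longrightarrow> H w = w ^ m * g w" "\<And>w. w \<in> ball 0 r \<Longrightarrow> g w \<noteq> 0"
    using holomorphic_factor_zero_nonconstant[OF holH S H0 nc] unfolding diff_zero by metis
  have dH: "deriv H w = of_nat m * w ^ (m - 1) * g w + w ^ m * deriv g w" if w: "w \<in> ball 0 r" for w
  proof -
    have "((\<lambda>w. w ^ m * g w) has_field_derivative of_nat m * w ^ (m - 1) * g w + w ^ m * deriv g w) (at w)"
      using holomorphic_derivI[OF f(4) open_ball w]
      by (auto intro!: derivative_eq_intros)
    then have "(H has_field_derivative of_nat m * w ^ (m - 1) * g w + w ^ m * deriv g w) (at w)"
      by (rule has_field_derivative_transform_within_open[of _ _ _ "ball 0 r"]) (use w f(5) in auto)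
    then show ?thesis by (rule DERIV_imp_deriv)
  qed
  have log_deriv: "w * deriv H w / H w = of_nat m + w * deriv g w / g w"
    if w: "w \<in> ball 0 r" "w \<noteq> 0" for w
  proof -
    have "w * deriv H w = w ^ m * (of_nat m * g w + w * deriv g w)"
      using dH[OF w(1)] \<open>0 < m\<close> by (cases m) (auto simp: algebra_simps)
    then show ?thesis
      using f(5,6)[OF w(1)] w(2) by (simp add: field_simps)
  qed
  have dg: "isCont (deriv g) 0" "isCont g 0"
    using f(2,4) holomorphic_deriv[OF f(4) open_ball]
    by (auto intro!: continuous_on_interior[of "ball 0 r"] holomorphic_on_imp_continuous_on)
  have "g 0 \<noteq> 0" using f by simp
  then have "(\<lambda>n. 1 - (of_nat m + y n * deriv g (y n) / g (y n)))
      \<longlonglongrightarrow> 1 - (of_nat m + 0 * deriv g 0 / g 0)"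
    by (intro tendsto_intros y isCont_tendsto_compose[OF dg(1) y] isCont_tendsto_compose[OF dg(2) y])
  then have lim: "(\<lambda>n. cmod (1 - (of_nat m + y n * deriv g (y n) / g (y n)))) \<longlonglongrightarrow> cmod (1 - of_nat m)"
    using tendsto_norm by fastforce
  have ev: "\<forall>\<^sub>F n in sequentially. y n \<in> ball 0 r"
    using y f(2) by (intro topological_tendstoD) auto
  have "cmod (1 - of_nat m) \<le> \<rho>"
  proof (rule tendsto_upperbound[OF lim])
    show "\<forall>\<^sub>F n in sequentially. cmod (1 - (of_nat m + y n * deriv g (y n) / g (y n))) \<le> \<rho>"
      using ev by eventually_elim (use log_deriv bd ynz in metis)
  qed auto
  moreover have "cmod (1 - of_nat m) = real m - 1"
    using \<open>0 < m\<close> by (cases m) auto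
  ultimately have "m = 1"
    using \<open>\<rho> < 1\<close> \<open>0 < m\<close> by linarith
  then show ?thesis
    using dH[of 0] f \<open>g 0 \<noteq> 0\<close> by simp
qed

text \<open>
  Here \<open>H = 1 - X / N\<close>, so a zero of \<open>X\<close> is a point on the level \<open>1\<close> of \<open>H\<close>, and \<open>H(0) = 0\<close>. The condition
  that \<open>X\<close> and \<open>N\<close> have no common zero keeps limits of points on finite levels away from the poles of \<open>H\<close>.
  The proof takes the infimum \<open>m\<close> of the levels that contain two distinct points within the region
  \<open>|x|\<^sup>2 \<le> \<rho>\<^sup>2 s\<close>, and limits of such pairs. If the two limits coincide, injectivity of \<open>H\<close> near the limit is
  contradicted; if they are distinct, then \<open>m > 0\<close> and both points continue to a level below \<open>m\<close>.
\<close>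

lemma at_most_one_zero:
  fixes X N :: "complex \<Rightarrow> complex"
  assumes holX: "X holomorphic_on ball 0 1" and holN: "N holomorphic_on ball 0 1"
    and at0: "X 0 = N 0" "N 0 \<noteq> 0"
    and nocommon: "\<And>x. x \<in> ball 0 1 \<Longrightarrow> X x = 0 \<Longrightarrow> N x \<noteq> 0"
    and bd: "\<And>x s. x \<in> ball 0 1 \<Longrightarrow> 0 < s \<Longrightarrow> s \<le> 1 \<Longrightarrow> (cmod x)\<^sup>2 < s \<Longrightarrow> N x \<noteq> 0 \<Longrightarrow>
       X x = (1 - of_real s) * N x \<Longrightarrow>
       cmod (1 - x * deriv (\<lambda>z. 1 - X z / N z) x / of_real s) \<le> cmod x / sqrt s"
    and x1: "x1 \<in> ball 0 1" "X x1 = 0" and x2: "x2 \<in> ball 0 1" "X x2 = 0"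
  shows "x1 = x2"
proof (rule ccontr)
  assume ne: "x1 \<noteq> x2"
  define H where "H = (\<lambda>z. 1 - X z / N z)"
  define K where "K = {x \<in> ball 0 1. N x \<noteq> 0}"
  have contX: "continuous_on (ball 0 1) X" and contN: "continuous_on (ball 0 1) N"
    using holX holN by (auto intro: holomorphic_on_imp_continuous_on)
  have opK: "open K"
  proof -
    have "K = ball 0 1 \<inter> N -` (- {0})" by (auto simp: K_def)
    then show ?thesis
      using continuous_open_preimage[OF contN open_ball, of "- {0}"] by auto
  qed
  have holH: "H holomorphic_on K"
    unfolding H_def using holX holN
    by (auto intro!: holomorphic_intros simp: K_def elim: holomorphic_on_subset)
  have K0: "0 \<in> K" and H0: "H 0 = 0"
    using at0 by (auto simp: K_def H_def)
  define \<rho> where "\<rho> = max (cmod x1) (cmod x2)"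
  have \<rho>: "0 < \<rho>" "\<rho> < 1"
    using ne x1 x2 by (auto simp: \<rho>_def max_def)
  have small: "(cmod x)\<^sup>2 < s" "cmod x / sqrt s \<le> \<rho>" if "0 < s" "(cmod x)\<^sup>2 \<le> \<rho>\<^sup>2 * s" for x s
  proof -
    have "\<rho>\<^sup>2 * s < 1 * s"
      using \<rho> that(1) by (intro mult_strict_right_mono) (auto simp: power_less_one_iff)
    with that(2) show "(cmod x)\<^sup>2 < s" by linarith
    have "cmod x \<le> sqrt (\<rho>\<^sup>2 * s)"
      using that by (intro real_le_rsqrt) auto
    then show "cmod x / sqrt s \<le> \<rho>"
      using \<rho> that(1) by (simp add: real_sqrt_mult field_simps)
  qed
  have bdH: "cmod (1 - x * deriv H x / of_real s) \<le> \<rho>"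
    if "x \<in> K" "0 < s" "s \<le> 1" "(cmod x)\<^sup>2 \<le> \<rho>\<^sup>2 * s" "H x = of_real s" for x s
  proof -
    have "X x = (1 - of_real s) * N x"
      using that by (simp add: H_def K_def field_simps)
    then show ?thesis
      using bd[of x s] small[OF that(2,4)] that by (fastforce simp: K_def H_def)
  qed
  \<comment> \<open>The region \<open>|x|\<^sup>2 \<le> \<rho>\<^sup>2 s\<close> is closed, lies where the bound applies, and is invariant under descent.\<close>
  define S where "S = {s. 0 < s \<and> s \<le> 1 \<and> (\<exists>y\<in>K. \<exists>y'\<in>K. y \<noteq> y' \<and> H y = of_real s \<and> H y' = of_real s
     \<and> (cmod y)\<^sup>2 \<le> \<rho>\<^sup>2 * s \<and> (cmod y')\<^sup>2 \<le> \<rho>\<^sup>2 * s)}"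
  have "1 \<in> S"
  proof -
    have "x1 \<in> K" "x2 \<in> K" "H x1 = 1" "H x2 = 1"
      using x1 x2 nocommon by (auto simp: K_def H_def)
    moreover have "(cmod x1)\<^sup>2 \<le> \<rho>\<^sup>2" "(cmod x2)\<^sup>2 \<le> \<rho>\<^sup>2"
      by (auto simp: \<rho>_def intro!: power_mono)
    ultimately show ?thesis
      unfolding S_def using ne by auto
  qed
  define m where "m = Inf S"
  have bddS: "bdd_below S"
    by (rule bdd_belowI[of _ 0]) (auto simp: S_def)
  have m_le: "m \<le> s" if "s \<in> S" for s
    unfolding m_def using that bddS by (rule cInf_lower)
  have m0: "0 \<le> m"
    unfolding m_def
  proof (rule cInf_greatest)
    show "S \<noteq> {}" using \<open>1 \<in> S\<close> by blast
  qed (simp add: S_def)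
  have "\<exists>s\<in>S. s < m + 1 / real (Suc n)" for n
    using cInf_lessD[of S "m + 1 / real (Suc n)"] \<open>1 \<in> S\<close> by (auto simp: m_def)
  then obtain s where s: "\<And>n. s n \<in> S" "\<And>n. s n < m + 1 / real (Suc n)"
    by metis
  have slim: "s \<longlonglongrightarrow> m"
  proof (rule tendsto_sandwich[of "\<lambda>_. m" s sequentially "\<lambda>n. m + 1 / real (Suc n)"])
    show "(\<lambda>n. m + 1 / real (Suc n)) \<longlonglongrightarrow> m"
      using tendsto_add[OF tendsto_const LIMSEQ_inverse_real_of_nat, of m]
      by (simp add: inverse_eq_divide)
    show "\<forall>\<^sub>F n in sequentially. m \<le> s n"
      using m_le s(1) by simp
    show "\<forall>\<^sub>F n in sequentially. s n \<le> m + 1 / real (Suc n)"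
      using s(2) by (intro always_eventually allI less_imp_le)
  qed simp
  have s01: "0 < s n" "s n \<le> 1" for n
    using s(1)[of n] by (auto simp: S_def)
  obtain y y' where y: "\<And>n. y n \<in> K" "\<And>n. y' n \<in> K" "\<And>n. y n \<noteq> y' n"
     "\<And>n. H (y n) = of_real (s n)" "\<And>n. H (y' n) = of_real (s n)"
     "\<And>n. (cmod (y n))\<^sup>2 \<le> \<rho>\<^sup>2 * s n" "\<And>n. (cmod (y' n))\<^sup>2 \<le> \<rho>\<^sup>2 * s n"
    using s(1) unfolding S_def by simp metis
  have in_cball: "z \<in> cball 0 \<rho>" if "(cmod z)\<^sup>2 \<le> \<rho>\<^sup>2 * s n" for z n
  proof -
    have "\<rho>\<^sup>2 * s n \<le> \<rho>\<^sup>2" using s01[of n] by (simp add: mult_left_le)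
    then have "(cmod z)\<^sup>2 \<le> \<rho>\<^sup>2" using that by linarith
    then have "cmod z \<le> \<rho>" by (rule power2_le_imp_le) (use \<rho> in simp)
    then show ?thesis by simp
  qed
  have "compact (cball (0::complex) \<rho> \<times> cball (0::complex) \<rho>)"
    by (intro compact_Times compact_cball)
  moreover have "\<forall>n. (y n, y' n) \<in> cball 0 \<rho> \<times> cball 0 \<rho>"
    using in_cball y(6,7) by blast
  ultimately obtain l r where l: "strict_mono (r :: nat \<Rightarrow> nat)" "((\<lambda>n. (y n, y' n)) \<circ> r) \<longlonglongrightarrow> l"
    unfolding compact_def by meson
  define a a' where "a = fst l" and "a' = snd l"
  have ya: "(\<lambda>n. y (r n)) \<longlonglongrightarrow> a" and ya': "(\<lambda>n. y' (r n)) \<longlonglongrightarrow> a'"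
    using tendsto_fst[OF l(2)] tendsto_snd[OF l(2)] by (simp_all add: a_def a'_def o_def)
  have sr: "(\<lambda>n. s (r n)) \<longlonglongrightarrow> m"
    using LIMSEQ_subseq_LIMSEQ[OF slim l(1)] by (simp add: o_def)
  have "m \<le> 1" using m_le \<open>1 \<in> S\<close> by blast
  \<comment> \<open>Both limit points are treated alike; only at \<open>m = 0\<close>, that is at the origin, is the order of the zero of \<open>H\<close> needed.\<close>
  have lim: "b \<in> K \<and> H b = of_real m \<and> (cmod b)\<^sup>2 \<le> \<rho>\<^sup>2 * m \<and> deriv H b \<noteq> 0"
    if b: "(\<lambda>n. v (r n)) \<longlonglongrightarrow> b"
      and v: "\<And>n. v n \<in> K" "\<And>n. H (v n) = of_real (s n)" "\<And>n. (cmod (v n))\<^sup>2 \<le> \<rho>\<^sup>2 * s n" for v b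
  proof -
    have "(cmod b)\<^sup>2 \<le> \<rho>\<^sup>2 * m"
      by (rule LIMSEQ_le[OF tendsto_power[OF tendsto_norm[OF b]] tendsto_mult[OF tendsto_const sr]])
         (use v in auto)
    have bball: "b \<in> ball 0 1"
    proof -
      have "(cmod b)\<^sup>2 \<le> \<rho>\<^sup>2 * 1"
        using \<open>(cmod b)\<^sup>2 \<le> \<rho>\<^sup>2 * m\<close> \<open>m \<le> 1\<close> mult_left_mono[of m 1 "\<rho>\<^sup>2"] by simp
      then have "cmod b \<le> \<rho>" using \<rho> power2_le_imp_le[of "cmod b" \<rho>] by simp
      then show ?thesis using \<rho> by simp
    qed
    have cb: "isCont X b" "isCont N b"
      using bball contX contN by (auto intro: continuous_on_interior)
    have "X (v n) = (1 - of_real (s n)) * N (v n)" for n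
      using v(1,2)[of n] by (simp add: H_def K_def field_simps)
    then have "(\<lambda>n. X (v (r n))) \<longlonglongrightarrow> (1 - of_real m) * N b"
      by (simp, intro tendsto_intros sr isCont_tendsto_compose[OF cb(2) b])
    then have Xb: "X b = (1 - of_real m) * N b"
      using isCont_tendsto_compose[OF cb(1) b] LIMSEQ_unique by blast
    then have "N b \<noteq> 0"
      using nocommon[OF bball] by auto
    then have bK: "b \<in> K" and Hb: "H b = of_real m"
      using bball Xb by (auto simp: K_def H_def)
    have "deriv H b \<noteq> 0"
    proof (cases "m = 0")
      case False
      then have "cmod (1 - b * deriv H b / of_real m) \<le> \<rho>"
        using bdH[OF bK _ \<open>m \<le> 1\<close> \<open>(cmod b)\<^sup>2 \<le> \<rho>\<^sup>2 * m\<close> Hb] m0 by simp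
      then show ?thesis using \<rho> by auto
    next
      case True
      then have b0: "b = 0" using \<open>(cmod b)\<^sup>2 \<le> \<rho>\<^sup>2 * m\<close> by simp
      obtain R where R: "R > 0" "ball 0 R \<subseteq> K"
        using opK K0 openE by blast
      have "\<not> H constant_on ball 0 R"
      proof
        assume "H constant_on ball 0 R"
        then have "H z = 0" if "z \<in> ball 0 R" for z
          using that R(1) H0 unfolding constant_on_def by (metis centre_in_ball)
        then have "\<forall>z\<in>ball 0 R. N z - X z = 0"
          using R(2) by (fastforce simp: H_def K_def)
        then have "N x1 - X x1 = 0"
          using analytic_continuation_open[of "ball 0 R" "ball 0 1" "\<lambda>z. N z - X z" "\<lambda>_. 0" x1]
            R holX holN x1 by (fastforce intro!: holomorphic_intros simp: K_def)
        then show False using nocommon x1 by simp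
      qed
      moreover have "H holomorphic_on ball 0 R"
        using holH R(2) holomorphic_on_subset by blast
      moreover have "v (r n) \<noteq> 0" for n
        using H0 v(2)[of "r n"] s01(1)[of "r n"] by auto
      moreover have "cmod (1 - v (r n) * deriv H (v (r n)) / H (v (r n))) \<le> \<rho>" for n
        using bdH[OF v(1) s01 v(3) v(2), of "r n"] v(2)[of "r n"] by simp
      ultimately show ?thesis
        unfolding b0
        using simple_zero_if_log_derivative_near_1[of H "ball 0 R" "\<lambda>n. v (r n)" \<rho>] R(1) H0 \<rho>(2) b b0
        by auto
    qed
    with bK Hb \<open>(cmod b)\<^sup>2 \<le> \<rho>\<^sup>2 * m\<close> show ?thesis by blast
  qed
  have A: "a \<in> K" "H a = of_real m" "(cmod a)\<^sup>2 \<le> \<rho>\<^sup>2 * m" "deriv H a \<noteq> 0"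
    using lim[of y a] ya y by blast+
  have A': "a' \<in> K" "H a' = of_real m" "(cmod a')\<^sup>2 \<le> \<rho>\<^sup>2 * m" "deriv H a' \<noteq> 0"
    using lim[of y' a'] ya' y by blast+
  show False
  proof (cases "a = a'")
    case True
    obtain t where t: "t > 0" "ball a t \<subseteq> K" "inj_on H (ball a t)"
      using has_complex_derivative_locally_injective[OF holH A(1) opK A(4)] by blast
    have "\<forall>\<^sub>F n in sequentially. y (r n) \<in> ball a t" "\<forall>\<^sub>F n in sequentially. y' (r n) \<in> ball a t"
      using topological_tendstoD[OF ya open_ball, of a t] topological_tendstoD[OF ya' open_ball, of a t]
        t(1) True by simp_all
    then have "\<forall>\<^sub>F n in sequentially. y (r n) = y' (r n)"
    proof eventually_elim
      case (elim n)
      then show ?case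
        using inj_onD[OF t(3), of "y (r n)" "y' (r n)"] y(4,5)[of "r n"] by simp
    qed
    then show False
      using y(3) by (simp add: eventually_False)
  next
    case False
    have mpos: "m > 0"
      using m0 A(3) A'(3) False by (cases "m = 0") auto
    define e where "e = dist a a' / 2"
    have e: "e > 0" using False by (simp add: e_def)
    have bda: "cmod (1 - a * deriv H a / of_real m) < 1"
      using bdH[OF A(1) mpos \<open>m \<le> 1\<close> A(3,2)] \<rho>(2) by linarith
    have bda': "cmod (1 - a' * deriv H a' / of_real m) < 1"
      using bdH[OF A'(1) mpos \<open>m \<le> 1\<close> A'(3,2)] \<rho>(2) by linarith
    obtain \<delta> where \<delta>: "\<delta> > 0" "\<And>\<tau>. m - \<delta> < \<tau> \<Longrightarrow> \<tau> < m \<Longrightarrow>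
       \<exists>z\<in>K \<inter> ball a e. H z = of_real \<tau> \<and> (cmod z)\<^sup>2 / \<tau> < (cmod a)\<^sup>2 / m"
      using level_curve_descends[OF holH opK A(1,2) mpos e bda] by blast
    obtain \<delta>' where \<delta>': "\<delta>' > 0" "\<And>\<tau>. m - \<delta>' < \<tau> \<Longrightarrow> \<tau> < m \<Longrightarrow>
       \<exists>z\<in>K \<inter> ball a' e. H z = of_real \<tau> \<and> (cmod z)\<^sup>2 / \<tau> < (cmod a')\<^sup>2 / m"
      using level_curve_descends[OF holH opK A'(1,2) mpos e bda'] by blast
    define \<tau> where "\<tau> = max (m / 2) (m - min \<delta> \<delta>' / 2)"
    have \<tau>: "0 < \<tau>" "\<tau> < m" "m - \<delta> < \<tau>" "m - \<delta>' < \<tau>"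
      using mpos \<delta>(1) \<delta>'(1) by (auto simp: \<tau>_def)
    obtain z where z: "z \<in> K" "z \<in> ball a e" "H z = of_real \<tau>" "(cmod z)\<^sup>2 / \<tau> < (cmod a)\<^sup>2 / m"
      using \<delta>(2)[OF \<tau>(3,2)] by blast
    obtain z' where z': "z' \<in> K" "z' \<in> ball a' e" "H z' = of_real \<tau>" "(cmod z')\<^sup>2 / \<tau> < (cmod a')\<^sup>2 / m"
      using \<delta>'(2)[OF \<tau>(4,2)] by blast
    have "z \<noteq> z'"
    proof
      assume "z = z'"
      then have "dist a a' < e + e"
        using z(2) z'(2) dist_triangle2[of a a' z] by (simp add: dist_commute)
      then show False by (simp add: e_def)
    qed
    have shrink: "(cmod w)\<^sup>2 \<le> \<rho>\<^sup>2 * \<tau>"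
      if "(cmod w)\<^sup>2 / \<tau> < (cmod c)\<^sup>2 / m" "(cmod c)\<^sup>2 \<le> \<rho>\<^sup>2 * m" for w c :: complex
    proof -
      have "(cmod c)\<^sup>2 / m \<le> \<rho>\<^sup>2" using that(2) mpos by (simp add: field_simps)
      then have "(cmod w)\<^sup>2 / \<tau> \<le> \<rho>\<^sup>2" using that(1) by linarith
      then show ?thesis using \<tau>(1) by (simp add: field_simps)
    qed
    have "\<tau> \<in> S"
      unfolding S_def using \<tau> \<open>m \<le> 1\<close> z(1,3) z'(1,3) \<open>z \<noteq> z'\<close> shrink[OF z(4) A(3)] shrink[OF z'(4) A'(3)]
      by auto
    then show False using m_le \<tau>(2) by fastforce
  qed
qed

section \<open>The Loewner quotient and its bound\<close>

text \<open>
  The Cayley transform \<open>(L - 1) / (L + 1)\<close> of the factor \<open>L\<close> of the Loewner equation, in the coordinate \<open>x = 1 / \<zeta>\<close>.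
  Here \<open>k(x) = h(1 / x)\<close>, \<open>x\<^sup>3 p(x)\<close> is the pre-Schwarzian of \<open>f\<close> at \<open>1 / x\<close>, and \<open>x\<^sup>3 q(x)\<close> is the difference of the
  pre-Schwarzians of \<open>f\<close> and \<open>g\<close>. All these functions are holomorphic at \<open>x = 0\<close>, and so is the quotient.
\<close>

definition loewner_quotient ::
  "complex \<Rightarrow> (complex \<Rightarrow> complex) \<Rightarrow> (complex \<Rightarrow> complex) \<Rightarrow> (complex \<Rightarrow> complex) \<Rightarrow> complex \<Rightarrow> complex \<Rightarrow> complex"
where
  "loewner_quotient \<alpha> k p q s x =
     (k x - 1) / k x / s
     + (1 / s - 1) * (- x * deriv k x / k x + x^2 * p x - 2 * \<alpha> * x^2 * q x)
     - \<alpha> * ((1 - s)^2 / s) * k x *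
         (\<alpha> * x^4 * (q x)^2 - 3 * x^2 * q x - x^3 * deriv q x - x^4 * p x * q x)"

text \<open>
  The Schwarz lemma for the strict bound \<open>|f| < 1\<close> is applied to \<open>c f\<close> with \<open>c < 1\<close>, and \<open>c\<close> tends to \<open>1\<close>.
\<close>

lemma schwarz_lemma_radius:
  assumes f: "f holomorphic_on ball 0 R" and R: "0 < R" and "f 0 = 0"
    and bd: "\<And>z. cmod z < R \<Longrightarrow> cmod (f z) \<le> 1" and z: "cmod z < R"
  shows "cmod (f z) \<le> cmod z / R"
proof (rule field_le_mult_one_interval)
  fix c :: real assume c: "0 < c" "c < 1"
  have maps: "cmod (of_real R * v) < R" if "cmod v < 1" for v
    using that R by (simp add: norm_mult)
  have hol: "(\<lambda>v. of_real c * f (of_real R * v)) holomorphic_on ball 0 1"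
  proof (intro holomorphic_intros holomorphic_on_compose_gen[OF _ f, unfolded o_def])
    show "(*) (complex_of_real R) ` ball 0 1 \<subseteq> ball 0 R"
      using maps by auto
  qed
  have lt: "cmod (of_real c * f (of_real R * v)) < 1" if "cmod v < 1" for v
  proof -
    have "c * cmod (f (of_real R * v)) \<le> c * 1"
      using bd[OF maps[OF that]] c by (intro mult_left_mono) auto
    then have "c * cmod (f (of_real R * v)) < 1" using c by linarith
    then show ?thesis using c by (simp add: norm_mult)
  qed
  have zR: "cmod (z / of_real R) < 1"
    using z R by (simp add: norm_divide)
  have "cmod (of_real c * f (of_real R * (z / of_real R))) \<le> cmod (z / of_real R)"
    by (rule Schwarz_Lemma(1)[OF hol _ lt zR]) (use \<open>f 0 = 0\<close> in auto)
  then show "c * cmod (f z) \<le> cmod z / R"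
    using c R by (simp add: norm_mult norm_divide)
qed

text \<open>
  The left-hand side is \<open>1 - x H' / H\<close> at a point where \<open>H = 1 - X / N\<close> equals \<open>s\<close>, with primes denoting values of
  derivatives. The formula for \<open>N'\<close> has \<open>r' = - x p r\<close> built in, where \<open>r(x) = f'(1 / x)\<close>. The
  quantities \<open>X\<close>, \<open>N\<close>, \<open>r\<close>, \<open>x X'\<close> and \<open>x N'\<close> are all multiples of \<open>y = N / k\<close>, which cancels.
\<close>

lemma log_derivative_identity:
  fixes x s k k' r p q q' X X' N N' \<alpha> :: complex
  assumes nz: "s \<noteq> 0" "k \<noteq> 0" "N \<noteq> 0"
    and N: "N = k * (r - \<alpha> * x^2 * X * q)"
    and N': "N' = k' * (r - \<alpha> * x^2 * X * q)
      + k * (- x * p * r - \<alpha> * (2 * x * X * q + x^2 * X' * q + x^2 * X * q'))"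
    and X': "r = X - x * X'"
    and X: "X = (1 - s) * N"
  shows "1 - x * (- (X' * N - X * N') / N^2) / s =
    (k - 1) / k / s + (1 / s - 1) * (- x * k' / k + x^2 * p - 2 * \<alpha> * x^2 * q)
     - \<alpha> * ((1 - s)^2 / s) * k * (\<alpha> * x^4 * q^2 - 3 * x^2 * q - x^3 * q' - x^4 * p * q)"
proof -
  define y where "y = r - \<alpha> * x^2 * X * q"
  have Ny: "N = k * y" and ynz: "y \<noteq> 0"
    using N nz by (auto simp: y_def)
  have Xy: "X = (1 - s) * k * y"
    using X Ny by simp
  define \<rho> where "\<rho> = 1 + \<alpha> * (1 - s) * k * x^2 * q"
  have r: "r = y * \<rho>"
    unfolding \<rho>_def using y_def Xy by (simp add: algebra_simps)
  have xX': "x * X' = y * ((1 - s) * k - \<rho>)"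
    using X' Xy r by (simp add: algebra_simps)
  have "x * N' = x * k' * y
      + k * (- (x^2) * p * r - \<alpha> * (2 * x^2 * X * q + x^2 * (x * X') * q + x^3 * X * q'))"
    unfolding N' y_def by (simp add: algebra_simps power2_eq_square power3_eq_cube)
  also have "\<dots> = y * (x * k' + k * (- (x^2) * p * \<rho> - \<alpha> * (2 * x^2 * ((1 - s) * k) * q
        + x^2 * ((1 - s) * k - \<rho>) * q + x^3 * ((1 - s) * k) * q')))"
    unfolding xX' r Xy by (simp add: algebra_simps)
  finally have xN': "x * N' = y * (x * k' + k * (- (x^2) * p * \<rho> - \<alpha> * (2 * x^2 * ((1 - s) * k) * q
        + x^2 * ((1 - s) * k - \<rho>) * q + x^3 * ((1 - s) * k) * q')))" .
  have "1 - x * (- (X' * N - X * N') / N^2) / s = 1 + (x * X' * N - X * (x * N')) / (N^2 * s)"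
    using nz by (simp add: field_simps)
  also have "\<dots> = 1 + (((1 - s) * k - \<rho>) - (1 - s) * (x * k' + k * (- (x^2) * p * \<rho>
        - \<alpha> * (2 * x^2 * ((1 - s) * k) * q + x^2 * ((1 - s) * k - \<rho>) * q + x^3 * ((1 - s) * k) * q')))) / (k * s)"
    unfolding xX' xN' Xy Ny using nz ynz by (simp add: power2_eq_square divide_simps) (simp add: algebra_simps)
  also have "\<dots> = (k - 1) / k / s + (1 / s - 1) * (- x * k' / k + x^2 * p - 2 * \<alpha> * x^2 * q)
     - \<alpha> * ((1 - s)^2 / s) * k * (\<alpha> * x^4 * q^2 - 3 * x^2 * q - x^3 * q' - x^4 * p * q)"
    unfolding \<rho>_def using nz by (simp add: divide_simps) (simp add: algebra_simps power2_eq_square power3_eq_cube power4_eq_xxxx)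
  finally show ?thesis .
qed

text \<open>
  The left-hand side is the expression of the criterion for \<open>|\<zeta>|\<^sup>2 = 1 / s\<close>, where \<open>c\<close> stands for \<open>\<zeta> / cnj \<zeta>\<close>.
  It uses \<open>S\<^sub>f - S\<^sub>g = Q' - P Q + Q\<^sup>2 / 2\<close>, where \<open>P\<close> is the pre-Schwarzian of \<open>f\<close> and \<open>Q\<close> the difference
  of the pre-Schwarzians.
\<close>

lemma loewner_quotient_in_exterior_variable:
  fixes x s k k' pf pg pf' pg' \<alpha> \<zeta> :: complex
  assumes nz: "s \<noteq> 0" "k \<noteq> 0" "\<zeta> \<noteq> 0" and x: "x = 1 / \<zeta>" and c: "c = s * \<zeta>^2"
  shows "(1 - k) / k * (1 / s) - (1 / s - 1) *
           (\<zeta> * (- k' / \<zeta>^2) / k + (1 - 2 * \<alpha>) * (\<zeta> * (pf / \<zeta>^3)) + 2 * \<alpha> * (\<zeta> * (pg / \<zeta>^3)))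
         + \<alpha> * (1 / s - 1)^2 * c * k * ((\<alpha> - 1/2) * (pf / \<zeta>^3 - pg / \<zeta>^3)^2
             + (- (3 * x^2 * pf + x^3 * pf') / \<zeta>^2 - 1/2 * (pf / \<zeta>^3)^2)
             - (- (3 * x^2 * pg + x^3 * pg') / \<zeta>^2 - 1/2 * (pg / \<zeta>^3)^2))
    = - ((k - 1) / k / s + (1 / s - 1) * (- x * k' / k + x^2 * pf - 2 * \<alpha> * x^2 * (pf - pg))
     - \<alpha> * ((1 - s)^2 / s) * k *
       (\<alpha> * x^4 * (pf - pg)^2 - 3 * x^2 * (pf - pg) - x^3 * (pf' - pg') - x^4 * pf * (pf - pg)))"
proof -
  have \<zeta>: "\<zeta> = 1 / x" "x \<noteq> 0" using x nz by auto
  have sq: "(1 / s - 1)^2 * c = (1 - s)^2 / s * (1 / x^2)"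
  proof -
    have "1 / s - 1 = (1 - s) / s" using nz by (simp add: field_simps)
    then show ?thesis
      unfolding c \<zeta>(1) using nz by (simp add: power_divide power2_eq_square)
  qed
  have A: "\<zeta> * (- k' / \<zeta>^2) / k = - x * k' / k" "\<zeta> * (pf / \<zeta>^3) = x^2 * pf" "\<zeta> * (pg / \<zeta>^3) = x^2 * pg"
    unfolding \<zeta>(1) using \<zeta>(2) by (simp_all add: field_simps power2_eq_square power3_eq_cube)
  define B where "B = (\<alpha> - 1/2) * (pf / \<zeta>^3 - pg / \<zeta>^3)^2
             + (- (3 * x^2 * pf + x^3 * pf') / \<zeta>^2 - 1/2 * (pf / \<zeta>^3)^2)
             - (- (3 * x^2 * pg + x^3 * pg') / \<zeta>^2 - 1/2 * (pg / \<zeta>^3)^2)"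
  define C where "C = \<alpha> * x^4 * (pf - pg)^2 - 3 * x^2 * (pf - pg) - x^3 * (pf' - pg') - x^4 * pf * (pf - pg)"
  have B: "B = x^2 * C"
    unfolding B_def C_def \<zeta>(1) using \<zeta>(2)
    by (simp add: power_divide) (simp add: algebra_simps power_numeral_reduce)
  have "\<alpha> * (1 / s - 1)^2 * c * k * B = \<alpha> * ((1 / s - 1)^2 * c) * k * B"
    by (simp only: mult.assoc)
  also have "\<dots> = \<alpha> * ((1 - s)^2 / s) * k * C"
    unfolding sq B using \<zeta>(2) by simp
  finally have last: "\<alpha> * (1 / s - 1)^2 * c * k * B = \<alpha> * ((1 - s)^2 / s) * k * C" .
  have first: "(1 - k) / k * (1 / s) = - ((k - 1) / k / s)"
    by (simp add: minus_divide_left)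
  show ?thesis
    unfolding A first last[unfolded B_def C_def] by (simp add: algebra_simps)
qed

section \<open>The class Sigma in the coordinate at infinity\<close>

lemma ext_disk_iff: "\<zeta> \<in> ext_disk \<longleftrightarrow> 1 < cmod \<zeta>"
  by (auto simp: ext_disk_def)

lemma open_ext_disk: "open ext_disk"
  by (simp add: ext_disk_def open_Compl)

lemma inverse_in_disk: "\<zeta> \<in> ext_disk \<Longrightarrow> 1 / \<zeta> \<in> ball 0 1"
  by (auto simp: ext_disk_iff norm_divide divide_less_eq_1)

lemma inverse_in_ext_disk: "x \<in> ball 0 1 \<Longrightarrow> x \<noteq> 0 \<Longrightarrow> 1 / x \<in> ext_disk"
  by (auto simp: ext_disk_iff norm_divide field_simps)

lemma has_derivative_inversion:
  assumes u: "u holomorphic_on ball 0 1" and F: "\<And>z. z \<in> ext_disk \<Longrightarrow> F z = u (1 / z)"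
    and \<zeta>: "\<zeta> \<in> ext_disk"
  shows "(F has_field_derivative - deriv u (1 / \<zeta>) / \<zeta>^2) (at \<zeta>)"
proof -
  have "\<zeta> \<noteq> 0" using \<zeta> by (auto simp: ext_disk_iff)
  have u': "(u has_field_derivative deriv u (1 / \<zeta>)) (at (1 / \<zeta>))"
    using holomorphic_derivI[OF u open_ball inverse_in_disk[OF \<zeta>]] .
  have "((\<lambda>z. 1 / z) has_field_derivative - 1 / \<zeta>^2) (at \<zeta>)"
    using \<open>\<zeta> \<noteq> 0\<close> by (auto intro!: derivative_eq_intros simp: power2_eq_square)
  from DERIV_chain2[OF u' this]
  have "((\<lambda>z. u (1 / z)) has_field_derivative - deriv u (1 / \<zeta>) / \<zeta>^2) (at \<zeta>)"
    by simp
  then show ?thesis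
    by (rule has_field_derivative_transform_within_open[OF _ open_ext_disk \<zeta>]) (simp add: F)
qed

lemma laurent_tail_holomorphic:
  fixes F :: "complex \<Rightarrow> complex"
  assumes "\<And>\<zeta>. \<zeta> \<in> ext_disk \<Longrightarrow> (\<lambda>n. c n / \<zeta> ^ n) sums F \<zeta>"
  obtains \<phi> where "\<phi> holomorphic_on ball 0 1" "\<And>\<zeta>. \<zeta> \<in> ext_disk \<Longrightarrow> F \<zeta> = \<phi> (1 / \<zeta>)"
proof -
  define \<phi> where "\<phi> x = (\<Sum>n. c n * x ^ n)" for x
  have sums: "(\<lambda>n. c n * x ^ n) sums \<phi> x" if "x \<in> ball 0 1" for x
  proof (cases "x = 0")
    case True
    have "summable (\<lambda>n. c n * 0 ^ n)" by (rule summable_0_powser)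
    then show ?thesis unfolding True \<phi>_def by (rule summable_sums)
  next
    case False
    then show ?thesis
      using assms[OF inverse_in_ext_disk[OF that False]]
      by (auto simp: \<phi>_def power_one_over divide_inverse power_inverse sums_iff)
  qed
  show ?thesis
  proof (rule that)
    show "\<phi> holomorphic_on ball 0 1"
      by (rule power_series_holomorphic[of _ _ c]) (use sums in simp)
    show "F \<zeta> = \<phi> (1 / \<zeta>)" if \<zeta>: "\<zeta> \<in> ext_disk" for \<zeta>
      using sums_unique2[OF assms[OF \<zeta>]] sums[OF inverse_in_disk[OF \<zeta>]]
      by (simp add: power_one_over divide_inverse power_inverse)
  qed
qed

text \<open>
  With \<open>x = 1 / \<zeta>\<close> everything attached to \<open>f\<close> becomes holomorphic on the whole unit disk. The derivative \<open>r(x) = f'(1 / x)\<close> has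
  no zero at points of the exterior because \<open>f\<close> is locally univalent and none at \<open>x = 0\<close> because \<open>b \<noteq> 0\<close>.
  The pre-Schwarzian vanishes to third order at infinity because \<open>f'\<close> has no term in \<open>1 / \<zeta>\<close>; the remaining
  factor is \<open>p\<close>.
\<close>

lemma locally_univalent_Sigma_at_infinity:
  assumes f: "f \<in> class_Sigma" and lu: "locally_univalent_on f ext_disk"
  obtains b \<phi> r p where "b \<noteq> 0" "\<phi> holomorphic_on ball 0 1" "r holomorphic_on ball 0 1" "p holomorphic_on ball 0 1"
    "\<And>\<zeta>. \<zeta> \<in> ext_disk \<Longrightarrow> f \<zeta> = b * \<zeta> + \<phi> (1 / \<zeta>)"
    "\<And>x. r x = b - x^2 * deriv \<phi> x"
    "\<And>x. x \<in> ball 0 1 \<Longrightarrow> r x \<noteq> 0"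
    "\<And>x. x \<in> ball 0 1 \<Longrightarrow> deriv r x = - x * p x * r x"
    "\<And>\<zeta>. \<zeta> \<in> ext_disk \<Longrightarrow> pre_schwarzian f \<zeta> = p (1 / \<zeta>) / \<zeta>^3"
    "\<And>\<zeta>. \<zeta> \<in> ext_disk \<Longrightarrow> deriv (pre_schwarzian f) \<zeta> =
        - (3 * (1 / \<zeta>)^2 * p (1 / \<zeta>) + (1 / \<zeta>)^3 * deriv p (1 / \<zeta>)) / \<zeta>^2"
proof -
  obtain b c where b: "b \<noteq> 0" "\<And>\<zeta>. \<zeta> \<in> ext_disk \<Longrightarrow> (\<lambda>n. c n / \<zeta> ^ n) sums (f \<zeta> - b * \<zeta>)"
    using f by (auto simp: class_Sigma_def)
  obtain \<phi> where \<phi>: "\<phi> holomorphic_on ball 0 1" "\<And>\<zeta>. \<zeta> \<in> ext_disk \<Longrightarrow> f \<zeta> - b * \<zeta> = \<phi> (1 / \<zeta>)"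
    using laurent_tail_holomorphic[of c "\<lambda>\<zeta>. f \<zeta> - b * \<zeta>"] b(2) by auto
  define r where "r = (\<lambda>x. b - x^2 * deriv \<phi> x)"
  define p where "p = (\<lambda>x. (2 * deriv \<phi> x + x * deriv (deriv \<phi>) x) / r x)"
  have d\<phi>: "deriv \<phi> holomorphic_on ball 0 1"
    using \<phi>(1) by (simp add: holomorphic_deriv)
  then have dd\<phi>: "deriv (deriv \<phi>) holomorphic_on ball 0 1"
    by (simp add: holomorphic_deriv)
  have r: "r holomorphic_on ball 0 1"
    unfolding r_def by (intro holomorphic_intros d\<phi>)
  have df: "(f has_field_derivative r (1 / \<zeta>)) (at \<zeta>)" if \<zeta>: "\<zeta> \<in> ext_disk" for \<zeta>
  proof -
    have "((\<lambda>z. f z - b * z) has_field_derivative - deriv \<phi> (1 / \<zeta>) / \<zeta>^2) (at \<zeta>)"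
      by (rule has_derivative_inversion[OF \<phi> \<zeta>])
    from DERIV_add[OF this DERIV_cmult[OF DERIV_ident, of b]]
    show ?thesis by (simp add: r_def power_divide algebra_simps)
  qed
  have holf: "f holomorphic_on ext_disk"
    using df open_ext_disk by (auto simp: holomorphic_on_open)
  have deriv_f: "deriv f \<zeta> = r (1 / \<zeta>)" if "\<zeta> \<in> ext_disk" for \<zeta>
    using df[OF that] by (rule DERIV_imp_deriv)
  have rnz: "r x \<noteq> 0" if x: "x \<in> ball 0 1" for x
  proof (cases "x = 0")
    case True
    then show ?thesis using b by (simp add: r_def)
  next
    case False
    have \<zeta>: "1 / x \<in> ext_disk" using inverse_in_ext_disk[OF x False] .
    obtain V where V: "open V" "1 / x \<in> V" "V \<subseteq> ext_disk" "inj_on f V"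
      using lu \<zeta> unfolding locally_univalent_on_def univalent_on_def by blast
    have "deriv f (1 / x) \<noteq> 0"
      using holomorphic_injective_imp_regular[OF _ V(1) V(4) V(2)] holf V(3) holomorphic_on_subset by blast
    then show ?thesis using deriv_f[OF \<zeta>] by simp
  qed
  have p: "p holomorphic_on ball 0 1"
    unfolding p_def by (intro holomorphic_intros d\<phi> dd\<phi> r) (use rnz in auto)
  have dr: "deriv r x = - x * p x * r x" if x: "x \<in> ball 0 1" for x
  proof -
    have "(r has_field_derivative - (2 * x * deriv \<phi> x + x^2 * deriv (deriv \<phi>) x)) (at x)"
      unfolding r_def using holomorphic_derivI[OF d\<phi> open_ball x]
      by (auto intro!: derivative_eq_intros simp: algebra_simps)
    then have "deriv r x = - (2 * x * deriv \<phi> x + x^2 * deriv (deriv \<phi>) x)"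
      by (rule DERIV_imp_deriv)
    moreover have "p x * r x = 2 * deriv \<phi> x + x * deriv (deriv \<phi>) x"
      using rnz[OF x] by (simp add: p_def)
    ultimately have "deriv r x = - x * (p x * r x)"
      by (simp only:) (simp add: power2_eq_square algebra_simps)
    then show ?thesis by simp
  qed
  have pre: "pre_schwarzian f \<zeta> = p (1 / \<zeta>) / \<zeta>^3" if \<zeta>: "\<zeta> \<in> ext_disk" for \<zeta>
  proof -
    have x: "1 / \<zeta> \<in> ball 0 1" using inverse_in_disk[OF \<zeta>] .
    have "deriv (deriv f) \<zeta> = - deriv r (1 / \<zeta>) / \<zeta>^2"
      by (rule DERIV_imp_deriv[OF has_derivative_inversion[OF r deriv_f \<zeta>]])
    then show ?thesis
      using rnz[OF x] by (simp add: pre_schwarzian_def deriv_f[OF \<zeta>] dr[OF x] power2_eq_square power3_eq_cube)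
  qed
  have dpre: "deriv (pre_schwarzian f) \<zeta> =
        - (3 * (1 / \<zeta>)^2 * p (1 / \<zeta>) + (1 / \<zeta>)^3 * deriv p (1 / \<zeta>)) / \<zeta>^2" if \<zeta>: "\<zeta> \<in> ext_disk" for \<zeta>
  proof -
    have "deriv (pre_schwarzian f) \<zeta> = - deriv (\<lambda>x. x^3 * p x) (1 / \<zeta>) / \<zeta>^2"
      by (rule DERIV_imp_deriv[OF has_derivative_inversion[OF _ _ \<zeta>]])
         (auto intro!: holomorphic_intros p simp: pre power_divide)
    moreover have "deriv (\<lambda>x. x^3 * p x) (1 / \<zeta>) = 3 * (1 / \<zeta>)^2 * p (1 / \<zeta>) + (1 / \<zeta>)^3 * deriv p (1 / \<zeta>)"
      by (rule DERIV_imp_deriv)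
         (use holomorphic_derivI[OF p open_ball inverse_in_disk[OF \<zeta>]] in
           \<open>auto intro!: derivative_eq_intros simp: algebra_simps\<close>)
    ultimately show ?thesis by simp
  qed
  have f_eq: "f \<zeta> = b * \<zeta> + \<phi> (1 / \<zeta>)" if "\<zeta> \<in> ext_disk" for \<zeta>
    using \<phi>(2)[OF that] by (simp add: algebra_simps)
  have r_eq: "r x = b - x^2 * deriv \<phi> x" for x
    by (simp add: r_def)
  show ?thesis
    by (rule that[OF b(1) \<phi>(1) r p f_eq r_eq rnz dr pre dpre])
qed

section \<open>The univalence criterion\<close>

text \<open>
  For a value \<open>w\<close> of \<open>f\<close>, put \<open>X(x) = x (f(1 / x) - w)\<close> and \<open>N = k (r - \<alpha> x\<^sup>2 X q)\<close>. Solving \<open>F(1 / x, s) = w\<close> for \<open>s\<close> gives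
  \<open>s = 1 - X / N\<close>, so injectivity of \<open>f\<close> is the statement that \<open>X\<close> has at most one zero. The bound needed
  for this is the Schwarz lemma for the Loewner quotient \<open>W s\<close> on the disk of radius \<open>\<surd>s\<close>: it vanishes at \<open>0\<close>, and
  its modulus is at most \<open>1\<close> on the boundary circle by hypothesis. For \<open>s = 1\<close> this circle is the boundary of the
  domain, where the hypothesis is not available, but then \<open>W 1 = (k - 1) / k\<close> and \<open>Re k \<ge> 1 / 2\<close> is
  the same as \<open>|W 1| \<le> 1\<close>.
\<close>

lemma univalent_if_loewner_bound:
  fixes f g h :: "complex \<Rightarrow> complex" and \<alpha> :: complex
  assumes Sigma: "f \<in> class_Sigma" "g \<in> class_Sigma"
    and lu: "locally_univalent_on f ext_disk" "locally_univalent_on g ext_disk"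
    and Reh: "\<And>\<zeta>. \<zeta> \<in> ext_disk \<Longrightarrow> Re (h \<zeta>) \<ge> 1/2"
    and hsums: "\<And>\<zeta>. \<zeta> \<in> ext_disk \<Longrightarrow> (\<lambda>n. c n / \<zeta> ^ (n + 2)) sums (h \<zeta> - 1)"
    and hyp: "\<And>\<zeta>. \<zeta> \<in> ext_disk \<Longrightarrow>
          cmod ((1 - h \<zeta>) / h \<zeta> * of_real ((cmod \<zeta>)\<^sup>2)
            - of_real ((cmod \<zeta>)\<^sup>2 - 1) *
                (\<zeta> * deriv h \<zeta> / h \<zeta>
                 + (1 - 2 * \<alpha>) * (\<zeta> * pre_schwarzian f \<zeta>)
                 + 2 * \<alpha> * (\<zeta> * pre_schwarzian g \<zeta>))
            + \<alpha> * of_real (((cmod \<zeta>)\<^sup>2 - 1)\<^sup>2) * (\<zeta> / cnj \<zeta>) * h \<zeta> *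
                ((\<alpha> - 1/2) * (pre_schwarzian f \<zeta> - pre_schwarzian g \<zeta>)\<^sup>2
                 + schwarzian f \<zeta> - schwarzian g \<zeta>))
          \<le> 1"
  shows "univalent_on f ext_disk"
proof -
  obtain b \<phi> r p where f: "b \<noteq> 0" "\<phi> holomorphic_on ball 0 1" "r holomorphic_on ball 0 1" "p holomorphic_on ball 0 1"
    "\<And>\<zeta>. \<zeta> \<in> ext_disk \<Longrightarrow> f \<zeta> = b * \<zeta> + \<phi> (1 / \<zeta>)"
    "\<And>x. r x = b - x^2 * deriv \<phi> x"
    "\<And>x. x \<in> ball 0 1 \<Longrightarrow> r x \<noteq> 0"
    "\<And>x. x \<in> ball 0 1 \<Longrightarrow> deriv r x = - x * p x * r x"
    "\<And>\<zeta>. \<zeta> \<in> ext_disk \<Longrightarrow> pre_schwarzian f \<zeta> = p (1 / \<zeta>) / \<zeta>^3"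
    "\<And>\<zeta>. \<zeta> \<in> ext_disk \<Longrightarrow> deriv (pre_schwarzian f) \<zeta> =
        - (3 * (1 / \<zeta>)^2 * p (1 / \<zeta>) + (1 / \<zeta>)^3 * deriv p (1 / \<zeta>)) / \<zeta>^2"
    using locally_univalent_Sigma_at_infinity[OF Sigma(1) lu(1)] by metis
  obtain p' where g: "p' holomorphic_on ball 0 1"
    "\<And>\<zeta>. \<zeta> \<in> ext_disk \<Longrightarrow> pre_schwarzian g \<zeta> = p' (1 / \<zeta>) / \<zeta>^3"
    "\<And>\<zeta>. \<zeta> \<in> ext_disk \<Longrightarrow> deriv (pre_schwarzian g) \<zeta> =
        - (3 * (1 / \<zeta>)^2 * p' (1 / \<zeta>) + (1 / \<zeta>)^3 * deriv p' (1 / \<zeta>)) / \<zeta>^2"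
    using locally_univalent_Sigma_at_infinity[OF Sigma(2) lu(2)] by metis
  define q where "q = (\<lambda>x. p x - p' x)"
  have q: "q holomorphic_on ball 0 1"
    unfolding q_def by (intro holomorphic_intros f g)
  have dq: "deriv q x = deriv p x - deriv p' x" if x: "x \<in> ball 0 1" for x
    unfolding q_def using holomorphic_derivI[OF f(4) open_ball x] holomorphic_derivI[OF g(1) open_ball x]
    by (intro DERIV_imp_deriv DERIV_diff)
  obtain \<kappa> where \<kappa>: "\<kappa> holomorphic_on ball 0 1"
    "\<And>\<zeta>. \<zeta> \<in> ext_disk \<Longrightarrow> (h \<zeta> - 1) * \<zeta>^2 = \<kappa> (1 / \<zeta>)"
  proof (rule laurent_tail_holomorphic[of c "\<lambda>\<zeta>. (h \<zeta> - 1) * \<zeta>^2"])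
    fix \<zeta> assume \<zeta>: "\<zeta> \<in> ext_disk"
    then have "\<zeta> \<noteq> 0" by (auto simp: ext_disk_iff)
    then show "(\<lambda>n. c n / \<zeta> ^ n) sums ((h \<zeta> - 1) * \<zeta>^2)"
      using sums_mult2[OF hsums[OF \<zeta>], of "\<zeta>^2"]
      by (simp only: power_add times_divide_eq_left nonzero_mult_divide_mult_cancel_right power_not_zero not_False_eq_True)
  qed blast
  define k where "k = (\<lambda>x. 1 + x^2 * \<kappa> x)"
  have k: "k holomorphic_on ball 0 1"
    unfolding k_def by (intro holomorphic_intros \<kappa>)
  have k0: "k 0 = 1" by (simp add: k_def)
  have hk: "h \<zeta> = k (1 / \<zeta>)" if "\<zeta> \<in> ext_disk" for \<zeta>
  proof -
    have "\<zeta> \<noteq> 0" using that by (auto simp: ext_disk_iff)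
    then show ?thesis
      by (simp add: k_def \<kappa>(2)[OF that, symmetric] power_divide)
  qed
  have Rek: "Re (k x) \<ge> 1/2" if "x \<in> ball 0 1" for x
    using k0 Reh[OF inverse_in_ext_disk[OF that]] hk[OF inverse_in_ext_disk[OF that]]
    by (cases "x = 0") auto
  then have knz: "k x \<noteq> 0" if "x \<in> ball 0 1" for x
    using that by fastforce
  define W where "W = (\<lambda>s. loewner_quotient \<alpha> k p q (complex_of_real s))"
  have W0: "W s 0 = 0" for s
    by (simp add: W_def loewner_quotient_def k0)
  have holW: "W s holomorphic_on ball 0 1" if "0 < s" for s
    unfolding W_def loewner_quotient_def
    by (intro holomorphic_intros k f q holomorphic_deriv open_ball) (use knz that in auto)
  have W_circle: "cmod (W s x) \<le> 1" if s: "0 < s" "s < 1" and x: "cmod x = sqrt s" for s x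
  proof -
    define \<zeta> where "\<zeta> = 1 / x"
    have x0: "x \<noteq> 0" and xb: "x \<in> ball 0 1"
      using s x by auto
    have \<zeta>: "\<zeta> \<in> ext_disk" "\<zeta> \<noteq> 0" and x\<zeta>: "x = 1 / \<zeta>"
      using inverse_in_ext_disk[OF xb x0] x0 by (auto simp: \<zeta>_def)
    have cz: "(cmod \<zeta>)\<^sup>2 = 1 / s"
      using s x by (simp add: \<zeta>_def norm_divide power_divide)
    have "\<zeta> * cnj \<zeta> = 1 / of_real s"
      unfolding complex_norm_square[symmetric] cz by simp
    then have cnj: "\<zeta> / cnj \<zeta> = of_real s * \<zeta>^2"
      using \<zeta>(2) s by (simp add: field_simps power2_eq_square)
    have dh: "deriv h \<zeta> = - deriv k x / \<zeta>^2"
      unfolding x\<zeta> by (rule DERIV_imp_deriv[OF has_derivative_inversion[OF k hk \<zeta>(1)]])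
    have "W s x = - ((1 - h \<zeta>) / h \<zeta> * of_real ((cmod \<zeta>)\<^sup>2)
            - of_real ((cmod \<zeta>)\<^sup>2 - 1) *
                (\<zeta> * deriv h \<zeta> / h \<zeta>
                 + (1 - 2 * \<alpha>) * (\<zeta> * pre_schwarzian f \<zeta>)
                 + 2 * \<alpha> * (\<zeta> * pre_schwarzian g \<zeta>))
            + \<alpha> * of_real (((cmod \<zeta>)\<^sup>2 - 1)\<^sup>2) * (\<zeta> / cnj \<zeta>) * h \<zeta> *
                ((\<alpha> - 1/2) * (pre_schwarzian f \<zeta> - pre_schwarzian g \<zeta>)\<^sup>2
                 + schwarzian f \<zeta> - schwarzian g \<zeta>))"
      using loewner_quotient_in_exterior_variable[OF _ knz[OF xb] \<zeta>(2) x\<zeta> cnj,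
        of "deriv k x" \<alpha> "p x" "p' x" "deriv p x" "deriv p' x"] s(1)
      by (simp add: W_def loewner_quotient_def schwarzian_def cz dh hk[OF \<zeta>(1)] f(9)[OF \<zeta>(1)] g(2)[OF \<zeta>(1)]
          f(10)[OF \<zeta>(1)] g(3)[OF \<zeta>(1)] x\<zeta>[symmetric] dq[OF xb] q_def[THEN fun_cong] add_diff_eq)
    then show ?thesis
      using hyp[OF \<zeta>(1)] by (simp only: norm_minus_cancel)
  qed
  have W_le: "cmod (W s x) \<le> cmod x / sqrt s" if s: "0 < s" "s \<le> 1" and x: "(cmod x)\<^sup>2 < s" for s x
  proof (rule schwarz_lemma_radius)
    have sub: "ball 0 (sqrt s) \<subseteq> ball (0::complex) 1"
      using s by (intro subset_ball) simp
    then show "W s holomorphic_on ball 0 (sqrt s)"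
      using holW[OF s(1)] holomorphic_on_subset by blast
    show "0 < sqrt s" "W s 0 = 0" using s W0 by auto
    show "cmod x < sqrt s" using x by (simp add: real_less_rsqrt)
    fix z :: complex assume z: "cmod z < sqrt s"
    show "cmod (W s z) \<le> 1"
    proof (cases "s = 1")
      case True
      then have zb: "z \<in> ball 0 1" using z by simp
      have "(cmod (k z - 1))\<^sup>2 \<le> (cmod (k z))\<^sup>2"
        using Rek[OF zb] unfolding cmod_power2 by (simp add: power2_eq_square algebra_simps)
      then have "cmod (k z - 1) \<le> cmod (k z)"
        by (rule power2_le_imp_le) simp
      then show ?thesis
        using knz[OF zb] True by (simp add: W_def loewner_quotient_def norm_divide)
    next
      case False
      have sub: "cball 0 (sqrt s) \<subseteq> ball (0::complex) 1"
      proof -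
        have "sqrt s < 1" using s False by simp
        then show ?thesis by (auto simp del: real_sqrt_lt_1_iff)
      qed
      show ?thesis
      proof (rule maximum_modulus_frontier[of "W s" "cball 0 (sqrt s)"])
        show "W s holomorphic_on interior (cball 0 (sqrt s))"
          using holW[OF s(1)] sub by (meson holomorphic_on_subset interior_subset order_trans)
        show "continuous_on (closure (cball 0 (sqrt s))) (W s)"
          using continuous_on_subset[OF holomorphic_on_imp_continuous_on[OF holW[OF s(1)]] sub] by simp
        show "cmod (W s w) \<le> 1" if "w \<in> frontier (cball 0 (sqrt s))" for w
          using that W_circle[of s w] s False by simp
      qed (use z in auto)
    qed
  qed
  show ?thesis
    unfolding univalent_on_def
  proof (rule inj_onI)
    fix z1 z2 assume z: "z1 \<in> ext_disk" "z2 \<in> ext_disk" and eq: "f z1 = f z2"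
    define X where "X = (\<lambda>x. b + x * (\<phi> x - f z1))"
    define N where "N = (\<lambda>x. k x * (r x - \<alpha> * x^2 * X x * q x))"
    have dX: "(X has_field_derivative \<phi> x - f z1 + x * deriv \<phi> x) (at x)" if "x \<in> ball 0 1" for x
      unfolding X_def using holomorphic_derivI[OF f(2) open_ball that]
      by (auto intro!: derivative_eq_intros)
    have zero: "X (1 / z) = 0" if "z \<in> ext_disk" "f z = f z1" for z
    proof -
      have "z \<noteq> 0" using that by (auto simp: ext_disk_iff)
      have "\<phi> (1 / z) = f z1 - b * z"
        using f(5)[OF that(1)] that(2) by simp
      then show ?thesis using \<open>z \<noteq> 0\<close> by (simp add: X_def)
    qed
    have "1 / z1 = 1 / z2"
    proof (rule at_most_one_zero[of X N])
      show holX: "X holomorphic_on ball 0 1"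
        unfolding X_def by (intro holomorphic_intros f)
      show holN: "N holomorphic_on ball 0 1"
        unfolding N_def by (intro holomorphic_intros holX k q f)
      show "X 0 = N 0" "N 0 \<noteq> 0"
        by (simp_all add: X_def N_def k0 f(6) f(1))
      show "N x \<noteq> 0" if "x \<in> ball 0 1" "X x = 0" for x
        using that knz f(7) by (simp add: N_def)
      show "cmod (1 - x * deriv (\<lambda>z. 1 - X z / N z) x / of_real s) \<le> cmod x / sqrt s"
        if x: "x \<in> ball 0 1" and s: "0 < s" "s \<le> 1" "(cmod x)\<^sup>2 < s" and Nx: "N x \<noteq> 0"
          and Xx: "X x = (1 - of_real s) * N x" for x s
      proof -
        define X' where "X' = \<phi> x - f z1 + x * deriv \<phi> x"
        define N' where "N' = deriv k x * (r x - \<alpha> * x^2 * X x * q x)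
          + k x * (- x * p x * r x - \<alpha> * (2 * x * X x * q x + x^2 * X' * q x + x^2 * X x * deriv q x))"
        have dN: "(N has_field_derivative N') (at x)"
          unfolding N_def N'_def
          using holomorphic_derivI[OF k open_ball x] holomorphic_derivI[OF f(3) open_ball x]
            holomorphic_derivI[OF q open_ball x] dX[OF x]
          by (auto intro!: derivative_eq_intros simp: f(8)[OF x] X'_def algebra_simps)
        have "((\<lambda>z. 1 - X z / N z) has_field_derivative - (X' * N x - X x * N') / (N x)^2) (at x)"
          using dX[OF x] dN Nx
          by (auto intro!: derivative_eq_intros simp: X'_def power2_eq_square diff_divide_distrib)
        then have d: "deriv (\<lambda>z. 1 - X z / N z) x = - (X' * N x - X x * N') / (N x)^2"
          by (rule DERIV_imp_deriv)
        have "r x = X x - x * X'"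
          by (simp add: f(6) X_def X'_def power2_eq_square algebra_simps)
        then have "1 - x * deriv (\<lambda>z. 1 - X z / N z) x / of_real s = W s x"
          unfolding d W_def loewner_quotient_def
          by (intro log_derivative_identity[OF _ knz[OF x] Nx _ N'_def _ Xx])
             (use s in \<open>auto simp: N_def\<close>)
        then show ?thesis
          using W_le[OF s] by simp
      qed
      show "1 / z1 \<in> ball 0 1" "1 / z2 \<in> ball 0 1"
        using z by (blast intro: inverse_in_disk)+
      show "X (1 / z1) = 0" "X (1 / z2) = 0"
        using z eq by (auto intro: zero)
    qed
    then show "z1 = z2" by simp
  qed
qed

theorem theorem3p1:
  fixes f g :: "complex \<Rightarrow> complex" and \<alpha> :: complex
  assumes "f \<in> class_Sigma" and "g \<in> class_Sigma"
    and "locally_univalent_on f ext_disk" and "locally_univalent_on g ext_disk"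
    and "\<exists>h. h analytic_on ext_disk
      \<and> (\<forall>\<zeta>\<in>ext_disk. Re (h \<zeta>) \<ge> 1/2)
      \<and> (\<exists>c. \<forall>\<zeta>\<in>ext_disk. (\<lambda>n. c n / \<zeta> ^ (n + 2)) sums (h \<zeta> - 1))
      \<and> (\<forall>\<zeta>\<in>ext_disk.
          cmod ((1 - h \<zeta>) / h \<zeta> * of_real ((cmod \<zeta>)\<^sup>2)
            - of_real ((cmod \<zeta>)\<^sup>2 - 1) *
                (\<zeta> * deriv h \<zeta> / h \<zeta>
                 + (1 - 2 * \<alpha>) * (\<zeta> * deriv (deriv f) \<zeta> / deriv f \<zeta>)
                 + 2 * \<alpha> * (\<zeta> * deriv (deriv g) \<zeta> / deriv g \<zeta>))
            + \<alpha> * of_real (((cmod \<zeta>)\<^sup>2 - 1)\<^sup>2) * (\<zeta> / cnj \<zeta>) * h \<zeta> *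
                ((\<alpha> - 1/2) * (deriv (deriv f) \<zeta> / deriv f \<zeta> - deriv (deriv g) \<zeta> / deriv g \<zeta>)\<^sup>2
                 + schwarzian f \<zeta> - schwarzian g \<zeta>))
          \<le> 1)"
  shows "univalent_on f ext_disk"
  using assms(5)
proof (elim exE conjE)
  fix h c
  assume Reh: "\<forall>\<zeta>\<in>ext_disk. Re (h \<zeta>) \<ge> 1/2"
    and hsums: "\<forall>\<zeta>\<in>ext_disk. (\<lambda>n. c n / \<zeta> ^ (n + 2)) sums (h \<zeta> - 1)"
    and bound: "\<forall>\<zeta>\<in>ext_disk.
          cmod ((1 - h \<zeta>) / h \<zeta> * of_real ((cmod \<zeta>)\<^sup>2)
            - of_real ((cmod \<zeta>)\<^sup>2 - 1) *
                (\<zeta> * deriv h \<zeta> / h \<zeta>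
                 + (1 - 2 * \<alpha>) * (\<zeta> * deriv (deriv f) \<zeta> / deriv f \<zeta>)
                 + 2 * \<alpha> * (\<zeta> * deriv (deriv g) \<zeta> / deriv g \<zeta>))
            + \<alpha> * of_real (((cmod \<zeta>)\<^sup>2 - 1)\<^sup>2) * (\<zeta> / cnj \<zeta>) * h \<zeta> *
                ((\<alpha> - 1/2) * (deriv (deriv f) \<zeta> / deriv f \<zeta> - deriv (deriv g) \<zeta> / deriv g \<zeta>)\<^sup>2
                 + schwarzian f \<zeta> - schwarzian g \<zeta>))
          \<le> 1"
  show ?thesis
  proof (rule univalent_if_loewner_bound[where \<alpha> = \<alpha>, OF assms(1-4)])
    show "Re (h \<zeta>) \<ge> 1/2" "(\<lambda>n. c n / \<zeta> ^ (n + 2)) sums (h \<zeta> - 1)" if "\<zeta> \<in> ext_disk" for \<zeta>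
      using Reh hsums that by blast+
  qed (use bound in \<open>simp only: pre_schwarzian_def times_divide_eq_right\<close>)
qed

end
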